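(* Let $C=(c^{(j,i)}_{n,m})$ and $D=(d^{(j,i)}_{n,m})$ be coefficients data of depths $k\ge1$ and $l\ge1$ respectively, and let $s=(s_1,\dots,s_k)$, $t=(t_1,\dots,t_l)$ be arguments. Then $$L_C(s)\cdot L_D(t)=\sum_\sigma L_{C*_\sigma D}(s+_\sigma t),$$ where the summation is taken over all $(k,l,p)$-shuffles with repetitions $\sigma$ (for all $p$ with $\max(k,l)\le p\le k+l$).
   Context: Coefficients data $C$ of depth $k$ is a family of complex numbers $c^{(j,i)}_{n,m}$ indexed by integers $k\ge j>i\ge0$ and $n>m\ge0$. The associated (formal) multiple Dirichlet series is $$L_C(s_1,\dots,s_k)=\sum_{0=u_0<u_1<\dots<u_k\in\mathbb{Z}}\frac{\prod_{k\ge j>i\ge0}c^{(j,i)}_{u_j,u_i}}{u_1^{s_1}u_2^{s_2}\cdots u_k^{s_k}}.$$ Series are treated as formal Dirichlet series in the arguments $s_i,t_j$ (formal infinite linear combinations of products $u_1^{-s_1}\cdots u_k^{-s_k}w_1^{-t_1}\cdots w_l^{-t_l}$, with $q^{-(s_a+t_b)}=q^{-s_a}q^{-t_b}$). A $(k,l,p)$-shuffle with repetitions is a pair $\sigma=(\sigma_1,\sigma_2)$ of strictly increasing maps $\sigma_1:[0,k]\to[0,p]$, $\sigma_2:[0,l]\to[0,p]$ of integer intervals with $\sigma_1(0)=\sigma_2(0)=0$ and $\sigma_1([0,k])\cup\sigma_2([0,l])=[0,p]$. An element $j\in[0,p]$ has multiplicity two if $j\in\sigma_1([0,k])\cap\sigma_2([0,l])$,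 and multiplicity one otherwise (so $0$ has multiplicity two). The coefficients data $E=C*_\sigma D=(e^{(j,i)}_{n,m})$ of depth $p$ is defined as follows for $p\ge j>i\ge0$: (A)$_1$ If $j$ and $i$ both have multiplicity one and both belong to the image of the same $\sigma_a$: $e^{(j,i)}_{n,m}=c^{(\sigma_1^{-1}(j),\sigma_1^{-1}(i))}_{n,m}$ if $a=1$, and $e^{(j,i)}_{n,m}=d^{(\sigma_2^{-1}(j),\sigma_2^{-1}(i))}_{n,m}$ if $a=2$. (A)$_2$ If $j$ and $i$ both have multiplicity one and belong to images of different $\sigma_a,\sigma_b$: $e^{(j,i)}_{n,m}=1$. (B) If exactly one of $j,i$ has multiplicity two, there is exactly one $a\in\{1,2\}$ such that $j$ and $i$ both belong to the image of $\sigma_a$; $e^{(j,i)}_{n,m}$ is defined by the same formulas as in (A)$_1$. (C) If both have multiplicity two: $e^{(j,i)}_{n,m}=c^{(\sigma_1^{-1}(j),\sigma_1^{-1}(i))}_{n,m}\,d^{(\sigma_2^{-1}(j),\sigma_2^{-1}(i))}_{n,m}$. The arguments $s+_\sigma t=(r_1,\dots,r_p)$ are defined by: $r_i=s_{\sigma_1^{-1}(i)}$ if $i$ has multiplicity one and lies in the image of $\sigma_1$; $r_i=t_{\sigma_2^{-1}(i)}$ if $i$ has multiplicity one and lies in the image of $\sigma_2$; $r_i=s_{\sigma_1^{-1}(i)}+t_{\sigma_2^{-1}(i)}$ if $i$ has multiplicity two. *)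

theory Defs
  imports Complex_Main "HOL-Library.Multiset" "HOL-Library.FuncSet"
begin

text \<open>
  Formal Dirichlet series in indeterminates of type \<open>'v\<close>: a monomial is a finite product of
  factors \<open>n\<^sup>-\<^sup>v\<close> with \<open>n\<close> a positive integer, encoded by the family of bases \<open>n\<close>, and a series
  is an arbitrary complex-valued function on monomials.
\<close>

typedef 'v dmonom = "{f :: 'v \<Rightarrow> nat. (\<forall>v. f v > 0) \<and> finite {v. f v \<noteq> 1}}"
  morphisms base Abs_dmonom
  by (rule exI[of _ "\<lambda>_. 1"]) simp

setup_lifting type_definition_dmonom

instantiation dmonom :: (type) comm_monoid_mult
begin

lift_definition one_dmonom :: "'a dmonom" is "\<lambda>_. 1" by simp

lift_definition times_dmonom :: "'a dmonom \<Rightarrow> 'a dmonom \<Rightarrow> 'a dmonom" is "\<lambda>f g v. f v * g v"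
proof -
  fix f g :: "'a \<Rightarrow> nat"
  assume f: "(\<forall>v. f v > 0) \<and> finite {v. f v \<noteq> 1}" and g: "(\<forall>v. g v > 0) \<and> finite {v. g v \<noteq> 1}"
  have "{v. f v * g v \<noteq> 1} \<subseteq> {v. f v \<noteq> 1} \<union> {v. g v \<noteq> 1}" by auto
  then have "finite {v. f v * g v \<noteq> 1}" using f g by (meson finite_UnI finite_subset)
  then show "(\<forall>v. f v * g v > 0) \<and> finite {v. f v * g v \<noteq> 1}" using f g by simp
qed

instance by standard (transfer, simp add: ac_simps fun_eq_iff)+

end

text \<open>
  An argument is a formal sum of indeterminates, encoded as a multiset, so that sums of arguments
  are sums of multisets.  \<open>dpow n r\<close> is \<open>n\<^sup>-\<^sup>r\<close>; the value at \<open>n = 0\<close> is junk and never used.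
\<close>

lift_definition dpow :: "nat \<Rightarrow> 'v multiset \<Rightarrow> 'v dmonom"
  is "\<lambda>n r v. if n = 0 then 1 else n ^ count r v"
proof -
  fix n :: nat and r :: "'v multiset"
  have "{v. (if n = 0 then 1 else n ^ count r v) \<noteq> 1} \<subseteq> set_mset r"
    by (auto split: if_splits simp flip: count_greater_zero_iff)
  then show "(\<forall>v. (if n = 0 then 1 else n ^ count r v) > 0) \<and>
      finite {v. (if n = 0 then 1 else n ^ count r v) \<noteq> 1}"
    by (auto intro: finite_subset)
qed

lemma dpow_add: "dpow n (r + r') = dpow n r * dpow n r'"
  by transfer (auto simp: power_add)

lemma finite_dmonom_factors: "finite {(a, b). a * b = (m :: 'v dmonom)}"
proof -
  let ?S = "{v. base m v \<noteq> 1}"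
  let ?F = "{g. \<forall>v. (v \<in> ?S \<longrightarrow> g v \<in> {..Max (base m ` ?S)}) \<and> (v \<notin> ?S \<longrightarrow> g v = 1)}"
  have finS: "finite ?S" using base[of m] by simp
  have finF: "finite ?F" by (rule finite_set_of_finite_funs) (use finS in auto)
  have sub: "base a \<in> ?F" if "a * b = m" for a b
  proof -
    have eq: "base m v = base a v * base b v" for v using that times_dmonom.rep_eq by metis
    have pos: "base b v > 0" for v using base[of b] by simp
    have le: "base a v \<le> base m v" for v unfolding eq using pos[of v] by simp
    have "base m v \<le> Max (base m ` ?S)" if "v \<in> ?S" for v
      using finS that by (intro Max_ge) auto
    then have "base a v \<in> {..Max (base m ` ?S)}" if "v \<in> ?S" for v
      using le[of v] that by (meson atMost_iff order_trans)
    moreover have "base a v = 1" if "v \<notin> ?S" for v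
      using that eq[of v] by simp
    ultimately show ?thesis by blast
  qed
  have finA: "finite (base -` ?F)"
    using finF by (rule finite_vimageI) (meson base_inject injI)
  have "{(a, b). a * b = m} \<subseteq> (base -` ?F) \<times> (base -` ?F)"
  proof (rule subrelI)
    fix a b assume "(a, b) \<in> {(a, b). a * b = m}"
    then have "a * b = m" "b * a = m" by (simp_all add: mult.commute)
    from this[THEN sub] show "(a, b) \<in> (base -` ?F) \<times> (base -` ?F)" by blast
  qed
  then show ?thesis using finA by (meson finite_SigmaI finite_subset)
qed

typedef 'v dseries = "UNIV :: ('v dmonom \<Rightarrow> complex) set"
  morphisms dcoeff Abs_dseries ..

setup_lifting type_definition_dseries

instantiation dseries :: (type) comm_monoid_add
begin

lift_definition zero_dseries :: "'a dseries" is "\<lambda>_. 0" .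

lift_definition plus_dseries :: "'a dseries \<Rightarrow> 'a dseries \<Rightarrow> 'a dseries" is "\<lambda>f g m. f m + g m" .

instance by standard (transfer, simp add: ac_simps)+

end

instantiation dseries :: (type) times
begin

lift_definition times_dseries :: "'a dseries \<Rightarrow> 'a dseries \<Rightarrow> 'a dseries"
  is "\<lambda>f g m. \<Sum>(a, b) \<in> {(a, b). a * b = m}. f a * g b" .

instance ..

end

text \<open>
  \<open>C j i n m\<close> is the coefficient with upper indices \<open>(j, i)\<close> and lower indices \<open>n, m\<close>.  For
  coefficients data of depth \<open>k\<close> only the values with \<open>k \<ge> j > i\<close> and \<open>n > m\<close> are relevant.
\<close>

type_synonym coeff_data = "nat \<Rightarrow> nat \<Rightarrow> nat \<Rightarrow> nat \<Rightarrow> complex"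

text \<open>
  The sequences \<open>0 = u\<^sub>0 < u\<^sub>1 < \<dots> < u\<^sub>k\<close> of integers; they are extended by \<open>undefined\<close> beyond \<open>k\<close>
  so that each one is represented by exactly one function.
\<close>

definition index_seqs :: "nat \<Rightarrow> (nat \<Rightarrow> nat) set" where
  "index_seqs k = {u \<in> {0..k} \<rightarrow>\<^sub>E UNIV. u 0 = 0 \<and> strict_mono_on {0..k} u}"

text \<open>
  The series \<open>L\<^sub>C(r\<^sub>1, \<dots>, r\<^sub>k)\<close>.  The infinite formal sum is taken coefficientwise; by
  \<open>finite_index_seqs_monom\<close> below, only finitely many sequences contribute to each monomial as long as
  none of the arguments is zero.
\<close>

lift_definition L_series :: "nat \<Rightarrow> coeff_data \<Rightarrow> (nat \<Rightarrow> 'v multiset) \<Rightarrow> 'v dseries"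
  is "\<lambda>k C r m. \<Sum>u \<in> {u \<in> index_seqs k. (\<Prod>i=1..k. dpow (u i) (r i)) = m}.
        \<Prod>(j, i) \<in> {(j, i). i < j \<and> j \<le> k}. C j i (u j) (u i)" .

lemma base_prod: "base (\<Prod>i\<in>A. f i) v = (\<Prod>i\<in>A. base (f i) v)"
  by (induction A rule: infinite_finite_induct)
    (simp_all add: one_dmonom.rep_eq times_dmonom.rep_eq)

lemma finite_index_seqs_monom:
  assumes "\<And>i. i \<in> {1..k} \<Longrightarrow> r i \<noteq> {#}"
  shows "finite {u \<in> index_seqs k. (\<Prod>i=1..k. dpow (u i) (r i)) = m}"
proof -
  have bound: "u i \<le> Max (base m ` {v. base m v \<noteq> 1} \<union> {1})"
    if u: "u \<in> index_seqs k" "(\<Prod>i=1..k. dpow (u i) (r i)) = m" and i: "i \<in> {0..k}" for u i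
  proof (cases "u i \<le> 1")
    case True
    have "finite (base m ` {v. base m v \<noteq> 1} \<union> {1})" using base[of m] by simp
    then have "1 \<le> Max (base m ` {v. base m v \<noteq> 1} \<union> {1})" by (intro Max_ge) auto
    then show ?thesis using True by linarith
  next
    case False
    moreover have "u 0 = 0" using u(1) by (simp add: index_seqs_def)
    ultimately have "i \<noteq> 0" by (cases "i = 0") simp_all
    then have i1: "i \<in> {1..k}" using i by auto
    then obtain v where v: "v \<in># r i" using assms by blast
    have "base (dpow (u i) (r i)) v dvd base m v"
      unfolding u(2)[symmetric] base_prod by (rule dvd_prodI) (use i1 in auto)
    moreover have "u i dvd base (dpow (u i) (r i)) v"
      using False v by (simp add: dpow.rep_eq dvd_power)
    ultimately have "u i dvd base m v" by (rule dvd_trans[rotated])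
    moreover have "base m v > 0" using base[of m] by simp
    ultimately have le: "u i \<le> base m v" by (simp add: dvd_imp_le)
    then have "base m v \<noteq> 1" using False by auto
    moreover have "finite (base m ` {v. base m v \<noteq> 1} \<union> {1})" using base[of m] by simp
    ultimately have "base m v \<le> Max (base m ` {v. base m v \<noteq> 1} \<union> {1})"
      by (intro Max_ge) auto
    then show ?thesis using le by linarith
  qed
  have "{u \<in> index_seqs k. (\<Prod>i=1..k. dpow (u i) (r i)) = m} \<subseteq>
      {0..k} \<rightarrow>\<^sub>E {..Max (base m ` {v. base m v \<noteq> 1} \<union> {1})}"
  proof
    fix u assume "u \<in> {u \<in> index_seqs k. (\<Prod>i=1..k. dpow (u i) (r i)) = m}"
    then have u: "u \<in> index_seqs k" "(\<Prod>i=1..k. dpow (u i) (r i)) = m" by blast+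
    then have "u \<in> extensional {0..k}" by (simp add: index_seqs_def PiE_def)
    then show "u \<in> {0..k} \<rightarrow>\<^sub>E {..Max (base m ` {v. base m v \<noteq> 1} \<union> {1})}"
      using bound[OF u] unfolding PiE_iff by blast
  qed
  then show ?thesis by (rule finite_subset) (intro finite_PiE; simp)
qed

text \<open>The \<open>(k, l, p)\<close>-shuffles with repetitions, as functions in extensional form.\<close>

definition shuffles_rep :: "nat \<Rightarrow> nat \<Rightarrow> nat \<Rightarrow> ((nat \<Rightarrow> nat) \<times> (nat \<Rightarrow> nat)) set" where
  "shuffles_rep k l p = {(\<sigma>1, \<sigma>2).
     \<sigma>1 \<in> {0..k} \<rightarrow>\<^sub>E {0..p} \<and> strict_mono_on {0..k} \<sigma>1 \<and> \<sigma>1 0 = 0 \<and>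
     \<sigma>2 \<in> {0..l} \<rightarrow>\<^sub>E {0..p} \<and> strict_mono_on {0..l} \<sigma>2 \<and> \<sigma>2 0 = 0 \<and>
     \<sigma>1 ` {0..k} \<union> \<sigma>2 ` {0..l} = {0..p}}"

lemma finite_shuffles_rep: "finite (shuffles_rep k l p)"
proof (rule finite_subset)
  show "shuffles_rep k l p \<subseteq> ({0..k} \<rightarrow>\<^sub>E {0..p}) \<times> ({0..l} \<rightarrow>\<^sub>E {0..p})"
    by (auto simp: shuffles_rep_def)
qed (intro finite_cartesian_product finite_PiE; simp)

text \<open>
  The coefficients data \<open>C *\<^sub>\<sigma> D\<close>.  An index has multiplicity two iff it lies in both images.  The
  branches are, in this order: both indices of multiplicity two; not so, but both in the image of
  \<open>\<sigma>\<^sub>1\<close>; likewise for \<open>\<sigma>\<^sub>2\<close>; both of multiplicity one and in different images.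
\<close>

definition shuffle_coeff ::
  "nat \<Rightarrow> nat \<Rightarrow> (nat \<Rightarrow> nat) \<times> (nat \<Rightarrow> nat) \<Rightarrow> coeff_data \<Rightarrow> coeff_data \<Rightarrow> coeff_data" where
  "shuffle_coeff k l \<sigma> C D j i n m =
    (let I1 = fst \<sigma> ` {0..k}; I2 = snd \<sigma> ` {0..l};
         c = C (inv_into {0..k} (fst \<sigma>) j) (inv_into {0..k} (fst \<sigma>) i) n m;
         d = D (inv_into {0..l} (snd \<sigma>) j) (inv_into {0..l} (snd \<sigma>) i) n m
     in if j \<in> I1 \<inter> I2 \<and> i \<in> I1 \<inter> I2 then c * d
        else if j \<in> I1 \<and> i \<in> I1 then c
        else if j \<in> I2 \<and> i \<in> I2 then d
        else 1)"

text \<open>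
  The arguments \<open>s +\<^sub>\<sigma> t\<close>; an index \<open>i \<le> p\<close> outside \<open>I1\<close> lies in \<open>I2\<close>, as the images cover \<open>{0..p}\<close>.
\<close>

definition shuffle_args ::
  "nat \<Rightarrow> nat \<Rightarrow> (nat \<Rightarrow> nat) \<times> (nat \<Rightarrow> nat) \<Rightarrow>
   (nat \<Rightarrow> 'v multiset) \<Rightarrow> (nat \<Rightarrow> 'v multiset) \<Rightarrow> nat \<Rightarrow> 'v multiset" where
  "shuffle_args k l \<sigma> s t i =
    (let I1 = fst \<sigma> ` {0..k}; I2 = snd \<sigma> ` {0..l};
         a = s (inv_into {0..k} (fst \<sigma>) i);
         b = t (inv_into {0..l} (snd \<sigma>) i)
     in if i \<in> I1 \<inter> I2 then a + b else if i \<in> I1 then a else b)"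

end

theory Submission
  imports Defs "HOL-Library.Infinite_Set"
begin

text \<open>
  Both sides are compared coefficient by coefficient.  The coefficient of a monomial on the left is
  a sum over pairs of sequences \<open>(u, w)\<close>, on the right it is a sum over triples \<open>(p, \<sigma>, x)\<close> of a
  length, a shuffle of that length and a sequence of that length, and these index sets are in
  bijection (\<open>bij_betw_merge\<close>).  Merging the values of \<open>u\<close> and \<open>w\<close> into one increasing sequence
  without duplicates gives \<open>x\<close>, and \<open>\<sigma>\<^sub>1\<close>, \<open>\<sigma>\<^sub>2\<close> record the places at which the values of \<open>u\<close> and of
  \<open>w\<close> end up; conversely \<open>u = x \<circ> \<sigma>\<^sub>1\<close> and \<open>w = x \<circ> \<sigma>\<^sub>2\<close>.  A place has multiplicity two exactly
  when \<open>u\<close> and \<open>w\<close> have a value in common there.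

  The bijection preserves the summands because, once a place outside an image is read as
  contributing neutrally, all cases in the definitions of \<open>C *\<^sub>\<sigma> D\<close> and \<open>s +\<^sub>\<sigma> t\<close> have the same
  form: the coefficient is a factor from \<open>C\<close> times a factor from \<open>D\<close>, and the argument is a summand from \<open>s\<close>
  plus a summand from \<open>t\<close> (\<open>shuffle_coeff_split\<close>, \<open>shuffle_args_split\<close>).  Hence the coefficient
  and the monomial of \<open>x\<close> split into those of \<open>u\<close> and \<open>w\<close>.
\<close>

section \<open>Increasing enumerations of finite sets\<close>

text \<open>
  The index of a value is the number of smaller values; so an increasing enumeration can be
  recovered from its image.
\<close>

lemma card_smaller_values:
  fixes x :: "nat \<Rightarrow> nat"
  assumes x: "strict_mono_on {0..p} x" and i: "i \<le> p"
  shows "card {y \<in> x ` {0..p}. y < x i} = i"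
proof -
  have "{y \<in> x ` {0..p}. y < x i} = x ` {..<i}"
    using i strict_mono_on_less[OF x] by fastforce
  moreover have "inj_on x {..<i}"
    using i by (intro inj_on_subset[OF strict_mono_on_imp_inj_on[OF x]]) auto
  ultimately show ?thesis by (simp add: card_image)
qed

lemma strict_mono_on_card_image:
  fixes x :: "nat \<Rightarrow> nat"
  assumes "strict_mono_on {0..p} x"
  shows "card (x ` {0..p}) = Suc p"
  using card_image[OF strict_mono_on_imp_inj_on[OF assms]] by simp

lemma strict_mono_on_image_unique:
  fixes x y :: "nat \<Rightarrow> nat"
  assumes x: "strict_mono_on {0..p} x" and y: "strict_mono_on {0..p} y"
    and eq: "x ` {0..p} = y ` {0..p}" and i: "i \<le> p"
  shows "x i = y i"
proof -
  from i eq obtain j where j: "j \<le> p" "x i = y j" by fastforce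
  then have "i = j"
    using card_smaller_values[OF x i] card_smaller_values[OF y j(1)] eq by simp
  with j show ?thesis by simp
qed

lemma index_seqs_eqI:
  assumes "x \<in> index_seqs p" "y \<in> index_seqs p" "x ` {0..p} = y ` {0..p}"
  shows "x = y"
proof (rule PiE_ext)
  show "x \<in> {0..p} \<rightarrow>\<^sub>E UNIV" "y \<in> {0..p} \<rightarrow>\<^sub>E UNIV"
    using assms by (simp_all add: index_seqs_def)
  show "x i = y i" if "i \<in> {0..p}" for i
    using assms that strict_mono_on_image_unique[of p x y i] by (simp add: index_seqs_def)
qed

lemma index_seqs_enumeration:
  assumes "finite U" "0 \<in> U" "card U = Suc p"
  obtains x where "x \<in> index_seqs p" "x ` {0..p} = U"
proof -
  obtain h where h: "bij_betw h {..<card U} U" "strict_mono_on {..<card U} h"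
    by (rule ex_bij_betw_strict_mono_card[OF assms(1)])
  have dom: "{..<card U} = {0..p}" using assms(3) by auto
  have im: "h ` {0..p} = U" using h(1) dom by (simp add: bij_betw_def)
  then obtain i where i: "i \<le> p" "h i = 0" using assms(2) by fastforce
  have "h 0 \<le> h i"
    using strict_mono_on_leD[OF h(2), of 0 i] i(1) unfolding dom by simp
  then have "h 0 = 0" using i by simp
  then have "restrict h {0..p} \<in> index_seqs p"
    using h(2) unfolding dom by (auto simp: index_seqs_def strict_mono_on_def)
  then show thesis using im by (intro that[of "restrict h {0..p}"]) simp_all
qed

section \<open>Merging two index sequences\<close>

definition subseq_along :: "nat \<Rightarrow> (nat \<Rightarrow> nat) \<Rightarrow> (nat \<Rightarrow> nat) \<Rightarrow> nat \<Rightarrow> nat" where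
  "subseq_along k f x = (\<lambda>i\<in>{0..k}. x (f i))"

lemma subseq_along_in_index_seqs:
  assumes x: "x \<in> index_seqs p"
    and f: "strict_mono_on {0..k} f" "f 0 = 0" "f ` {0..k} \<subseteq> {0..p}"
  shows "subseq_along k f x \<in> index_seqs k"
proof -
  have "x (f i) < x (f j)" if "i < j" "j \<le> k" for i j
  proof -
    have "f i \<in> {0..p}" "f j \<in> {0..p}" using f(3) that by (auto simp: image_subset_iff)
    moreover have "f i < f j" using f(1) that by (simp add: strict_mono_on_def)
    ultimately show ?thesis using x by (simp add: index_seqs_def strict_mono_on_def)
  qed
  then show ?thesis
    using x f(2) by (auto simp: index_seqs_def subseq_along_def strict_mono_on_def)
qed

lemma image_subseq_along: "subseq_along k f x ` {0..k} = x ` (f ` {0..k})"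
  by (auto simp: subseq_along_def)

lemma subseq_along_inj:
  assumes x: "x \<in> index_seqs p"
    and f: "f \<in> {0..k} \<rightarrow>\<^sub>E {0..p}" and g: "g \<in> {0..k} \<rightarrow>\<^sub>E {0..p}"
    and eq: "subseq_along k f x = subseq_along k g x"
  shows "f = g"
proof (rule PiE_ext[OF f g])
  fix i assume i: "i \<in> {0..k}"
  have "inj_on x {0..p}" using x by (simp add: index_seqs_def strict_mono_on_imp_inj_on)
  moreover have "x (f i) = x (g i)" using fun_cong[OF eq, of i] i by (simp add: subseq_along_def)
  moreover have "f i \<in> {0..p}" "g i \<in> {0..p}" using f g i by (auto simp: PiE_iff)
  ultimately show "f i = g i" by (simp add: inj_on_def)
qed

text \<open>
  Every value of \<open>u\<close> has a place in \<open>x\<close>, and the map sending an index of \<open>u\<close> to that place is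
  increasing because both sequences are.  Applied to the two sequences being merged, this produces
  the two halves of the shuffle.
\<close>

lemma subseq_along_exists:
  assumes x: "x \<in> index_seqs p" and u: "u \<in> index_seqs k" and sub: "u ` {0..k} \<subseteq> x ` {0..p}"
  obtains f where "f \<in> {0..k} \<rightarrow>\<^sub>E {0..p}" "strict_mono_on {0..k} f" "f 0 = 0"
    "subseq_along k f x = u"
proof -
  define f where "f = (\<lambda>i\<in>{0..k}. inv_into {0..p} x (u i))"
  have xm: "strict_mono_on {0..p} x" and x0: "x 0 = 0" using x by (simp_all add: index_seqs_def)
  have um: "strict_mono_on {0..k} u" and u0: "u 0 = 0" using u by (simp_all add: index_seqs_def)
  have xf: "x (f i) = u i" and fp: "f i \<le> p" if i: "i \<le> k" for i
  proof -
    have ui: "u i \<in> x ` {0..p}" using sub i by (auto simp: image_subset_iff)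
    show "x (f i) = u i" using f_inv_into_f[OF ui] i by (simp add: f_def)
    show "f i \<le> p" using inv_into_into[OF ui] i by (simp add: f_def)
  qed
  have f: "f \<in> {0..k} \<rightarrow>\<^sub>E {0..p}" using fp by (auto simp: f_def)
  have "f i < f j" if "i < j" "j \<le> k" for i j
  proof -
    have "x (f i) < x (f j)" using um that by (simp add: xf strict_mono_on_def)
    then show ?thesis using strict_mono_on_less[OF xm] fp that by simp
  qed
  then have "strict_mono_on {0..k} f" by (simp add: strict_mono_on_def)
  moreover have "f 0 = 0"
    using strict_mono_on_imp_inj_on[OF xm] xf[of 0] fp[of 0] x0 u0 by (simp add: inj_on_def)
  moreover have "subseq_along k f x = u"
  proof (rule PiE_ext)
    show "subseq_along k f x \<in> {0..k} \<rightarrow>\<^sub>E UNIV" by (simp add: subseq_along_def)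
    show "u \<in> {0..k} \<rightarrow>\<^sub>E UNIV" using u by (simp add: index_seqs_def)
  qed (simp add: subseq_along_def xf)
  ultimately show thesis using f that by blast
qed

lemma shuffles_repD:
  assumes "(f, g) \<in> shuffles_rep k l p"
  shows "f \<in> {0..k} \<rightarrow>\<^sub>E {0..p}" "strict_mono_on {0..k} f" "f 0 = 0" "f ` {0..k} \<subseteq> {0..p}"
    and "g \<in> {0..l} \<rightarrow>\<^sub>E {0..p}" "strict_mono_on {0..l} g" "g 0 = 0" "g ` {0..l} \<subseteq> {0..p}"
    and "f ` {0..k} \<union> g ` {0..l} = {0..p}"
  using assms by (auto simp: shuffles_rep_def)

text \<open>
  For injectivity, the two subsequences determine the set of values of the merged sequence, because
  the places of a shuffle cover \<open>{0..p}\<close>; this set determines \<open>p\<close> and \<open>x\<close>, and \<open>x\<close>, being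
  injective, determines the shuffle.  For surjectivity, \<open>x\<close> enumerates the union of the two sets
  of values.
\<close>

lemma bij_betw_merge:
  "bij_betw (\<lambda>(p, (f, g), x). (subseq_along k f x, subseq_along l g x))
     (SIGMA p:{max k l..k + l}. shuffles_rep k l p \<times> index_seqs p)
     (index_seqs k \<times> index_seqs l)"
  (is "bij_betw ?F ?T ?P")
proof (rule bij_betw_imageI)
  show "inj_on ?F ?T"
  proof (rule inj_onI)
    fix y y'
    assume y: "y \<in> ?T" and y': "y' \<in> ?T" and eq: "?F y = ?F y'"
    obtain p f g x where y_eq: "y = (p, (f, g), x)"
      and fg: "(f, g) \<in> shuffles_rep k l p" and x: "x \<in> index_seqs p"
      using y by auto
    obtain p' f' g' x' where y'_eq: "y' = (p', (f', g'), x')"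
      and fg': "(f', g') \<in> shuffles_rep k l p'" and x': "x' \<in> index_seqs p'"
      using y' by auto
    have eqf: "subseq_along k f x = subseq_along k f' x'"
      and eqg: "subseq_along l g x = subseq_along l g' x'"
      using eq by (simp_all add: y_eq y'_eq)
    note d = shuffles_repD[OF fg] and d' = shuffles_repD[OF fg']
    \<comment> \<open>The values of the merged sequence are the values of the two given ones.\<close>
    have im: "x ` {0..p} = subseq_along k f x ` {0..k} \<union> subseq_along l g x ` {0..l}"
      unfolding image_subseq_along d(9)[symmetric] by (rule image_Un)
    have im': "x' ` {0..p'} = subseq_along k f' x' ` {0..k} \<union> subseq_along l g' x' ` {0..l}"
      unfolding image_subseq_along d'(9)[symmetric] by (rule image_Un)
    have same: "x ` {0..p} = x' ` {0..p'}" unfolding im im' eqf eqg ..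
    have "Suc p = Suc p'"
      using strict_mono_on_card_image[of p x] strict_mono_on_card_image[of p' x'] x x' same
      by (simp add: index_seqs_def)
    then have p: "p' = p" by simp
    have x_eq: "x' = x" using index_seqs_eqI[OF x] x' same p by simp
    show "y = y'"
      using subseq_along_inj[OF x d(1) d'(1)[unfolded p]]
        subseq_along_inj[OF x d(5) d'(5)[unfolded p]] eqf eqg x_eq p
      by (simp add: y_eq y'_eq)
  qed
  show "?F ` ?T = ?P"
  proof (intro equalityI subsetI)
    fix z assume "z \<in> ?F ` ?T"
    then show "z \<in> ?P"
      by (auto intro: subseq_along_in_index_seqs dest: shuffles_repD)
  next
    fix z assume "z \<in> ?P"
    then obtain u w where z: "z = (u, w)" and u: "u \<in> index_seqs k" and w: "w \<in> index_seqs l"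
      by blast
    define A where "A = u ` {0..k}"
    define B where "B = w ` {0..l}"
    define p where "p = card (A \<union> B) - 1"
    have zero: "0 \<in> A" "0 \<in> B"
      using u w by (force simp: A_def B_def index_seqs_def)+
    have fin: "finite A" "finite B" by (simp_all add: A_def B_def)
    have card: "card A = Suc k" "card B = Suc l"
      using u w by (simp_all add: A_def B_def index_seqs_def strict_mono_on_card_image)
    have "card A \<le> card (A \<union> B)" "card B \<le> card (A \<union> B)"
      using fin by (simp_all add: card_mono)
    \<comment> \<open>The common value 0 makes the upper bound \<open>k + l\<close> rather than \<open>k + l + 1\<close>.\<close>
    moreover have "card (A \<inter> B) \<ge> 1"
      using zero fin by (simp add: Suc_le_eq card_gt_0_iff) blast
    moreover have "card A + card B = card (A \<union> B) + card (A \<inter> B)"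
      using fin by (rule card_Un_Int)
    ultimately have p: "card (A \<union> B) = Suc p" "p \<in> {max k l..k + l}"
      using card unfolding p_def atLeastAtMost_iff max.bounded_iff by linarith+
    obtain x where x: "x \<in> index_seqs p" "x ` {0..p} = A \<union> B"
      by (rule index_seqs_enumeration[of "A \<union> B" p]) (use fin zero p in simp_all)
    obtain f where f: "f \<in> {0..k} \<rightarrow>\<^sub>E {0..p}" "strict_mono_on {0..k} f" "f 0 = 0"
      "subseq_along k f x = u"
      by (rule subseq_along_exists[OF x(1) u]) (use x(2) in \<open>auto simp: A_def\<close>)
    obtain g where g: "g \<in> {0..l} \<rightarrow>\<^sub>E {0..p}" "strict_mono_on {0..l} g" "g 0 = 0"
      "subseq_along l g x = w"
      by (rule subseq_along_exists[OF x(1) w]) (use x(2) in \<open>auto simp: B_def\<close>)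
    have "x ` (f ` {0..k} \<union> g ` {0..l}) = x ` {0..p}"
      unfolding image_Un image_subseq_along[symmetric] f(4) g(4) x(2) A_def B_def ..
    moreover have "inj_on x {0..p}"
      using x(1) by (simp add: index_seqs_def strict_mono_on_imp_inj_on)
    moreover have "f ` {0..k} \<union> g ` {0..l} \<subseteq> {0..p}" using f(1) g(1) by auto
    ultimately have "f ` {0..k} \<union> g ` {0..l} = {0..p}"
      by (simp add: inj_on_image_eq_iff)
    then have "(f, g) \<in> shuffles_rep k l p"
      using f(1-3) g(1-3) by (simp add: shuffles_rep_def)
    then have "(p, (f, g), x) \<in> ?T" using p(2) x(1) by blast
    moreover have "?F (p, (f, g), x) = z" using f(4) g(4) z by simp
    ultimately show "z \<in> ?F ` ?T" by (metis (no_types, lifting) image_eqI)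
  qed
qed

section \<open>Splitting the merged monomials and coefficients\<close>

definition seq_monom :: "nat \<Rightarrow> (nat \<Rightarrow> 'v multiset) \<Rightarrow> (nat \<Rightarrow> nat) \<Rightarrow> 'v dmonom" where
  "seq_monom k r u = (\<Prod>i=1..k. dpow (u i) (r i))"

definition seq_coeff :: "nat \<Rightarrow> coeff_data \<Rightarrow> (nat \<Rightarrow> nat) \<Rightarrow> complex" where
  "seq_coeff k C u = (\<Prod>(j, i) \<in> {(j, i). i < j \<and> j \<le> k}. C j i (u j) (u i))"

lemma dcoeff_L_series:
  "dcoeff (L_series k C r) m =
    (\<Sum>u \<in> {u \<in> index_seqs k. seq_monom k r u = m}. seq_coeff k C u)"
  by (simp add: L_series.rep_eq seq_monom_def seq_coeff_def)

lemma dpow_empty: "dpow n {#} = 1"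
  by transfer auto

lemma finite_ordered_pairs: "finite {(j, i). i < j \<and> j \<le> (p :: nat)}"
  by (rule finite_subset[of _ "{0..p} \<times> {0..p}"]) auto

text \<open>
  The next two lemmas replace the case distinction on multiplicities by one on membership in each
  image separately, so that the contributions of the two factors can be collected independently.
\<close>

lemma shuffle_args_split:
  assumes "(f, g) \<in> shuffles_rep k l p" "i \<le> p"
  shows "shuffle_args k l (f, g) s t i =
    (if i \<in> f ` {0..k} then s (inv_into {0..k} f i) else {#}) +
    (if i \<in> g ` {0..l} then t (inv_into {0..l} g i) else {#})"
proof -
  have "i \<in> f ` {0..k} \<union> g ` {0..l}" using shuffles_repD(9)[OF assms(1)] assms(2) by simp
  then show ?thesis
    unfolding shuffle_args_def Let_def fst_conv snd_conv
    by (cases "i \<in> f ` {0..k}"; cases "i \<in> g ` {0..l}"; simp)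
qed

lemma shuffle_coeff_split:
  "shuffle_coeff k l (f, g) C D j i n m =
    (if j \<in> f ` {0..k} \<and> i \<in> f ` {0..k}
     then C (inv_into {0..k} f j) (inv_into {0..k} f i) n m else 1) *
    (if j \<in> g ` {0..l} \<and> i \<in> g ` {0..l}
     then D (inv_into {0..l} g j) (inv_into {0..l} g i) n m else 1)"
  unfolding shuffle_coeff_def Let_def fst_conv snd_conv
  by (cases "j \<in> f ` {0..k}"; cases "i \<in> f ` {0..k}"; cases "j \<in> g ` {0..l}";
      cases "i \<in> g ` {0..l}"; simp)

lemma prod_supported_on_image:
  assumes "finite A" "h ` B \<subseteq> A" "inj_on h B"
    and "\<And>a. a \<in> A - h ` B \<Longrightarrow> F a = 1" and "\<And>b. b \<in> B \<Longrightarrow> F (h b) = G b"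
  shows "prod F A = prod G B"
proof -
  have "prod F A = prod F (h ` B)"
    using assms(1,2,4) by (intro prod.mono_neutral_right) auto
  also have "\<dots> = prod G B" using assms(3,5) by (simp add: prod.reindex)
  finally show ?thesis .
qed

text \<open>
  The places outside the image of \<open>f\<close> contribute \<open>1\<close>, since their argument is zero.  The condition
  \<open>f 0 = 0\<close> matches the two products, which both leave out the place \<open>0\<close>.
\<close>

lemma prod_dpow_along:
  fixes f :: "nat \<Rightarrow> nat"
  assumes f: "strict_mono_on {0..k} f" "f 0 = 0" "f ` {0..k} \<subseteq> {0..p}"
  shows "(\<Prod>i=1..p. dpow (x i) (if i \<in> f ` {0..k} then s (inv_into {0..k} f i) else {#})) =
    seq_monom k s (subseq_along k f x)"
  unfolding seq_monom_def
proof (rule prod_supported_on_image[where h = f])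
  have inj: "inj_on f {0..k}" using f(1) by (rule strict_mono_on_imp_inj_on)
  show "inj_on f {1..k}" by (rule inj_on_subset[OF inj]) auto
  show "f ` {1..k} \<subseteq> {1..p}"
  proof
    fix y assume "y \<in> f ` {1..k}"
    then obtain i where i: "i \<in> {1..k}" "y = f i" by blast
    then have "f 0 < f i" using f(1) by (simp add: strict_mono_on_def)
    moreover have "f i \<in> {0..p}" using i(1) f(3) by (auto simp: image_subset_iff)
    ultimately show "y \<in> {1..p}" using i by simp
  qed
  show "dpow (x i) (if i \<in> f ` {0..k} then s (inv_into {0..k} f i) else {#}) = 1"
    if "i \<in> {1..p} - f ` {1..k}" for i
  proof -
    have "i \<notin> f ` {0..k}"
    proof
      assume "i \<in> f ` {0..k}"
      then obtain j where j: "j \<le> k" "i = f j" by auto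
      then show False using that f(2) by (cases "j = 0") auto
    qed
    then show ?thesis by (simp only: if_False dpow_empty)
  qed
  show "dpow (x (f i)) (if f i \<in> f ` {0..k} then s (inv_into {0..k} f (f i)) else {#}) =
      dpow (subseq_along k f x i) (s i)" if "i \<in> {1..k}" for i
    using that inv_into_f_f[OF inj, of i] by (simp add: subseq_along_def)
qed simp

text \<open>
  A pair of places contributes only if both lie in the image of \<open>f\<close>; since \<open>f\<close> is increasing, these
  pairs are the images of the pairs \<open>i < j\<close> of indices.
\<close>

lemma prod_pairs_along:
  fixes f :: "nat \<Rightarrow> nat" and C :: coeff_data
  assumes f: "strict_mono_on {0..k} f" "f ` {0..k} \<subseteq> {0..p}"
  shows "(\<Prod>(j, i) \<in> {(j, i). i < j \<and> j \<le> p}. if j \<in> f ` {0..k} \<and> i \<in> f ` {0..k}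
      then C (inv_into {0..k} f j) (inv_into {0..k} f i) (x j) (x i) else 1) =
    seq_coeff k C (subseq_along k f x)"
  unfolding seq_coeff_def
proof (rule prod_supported_on_image[where h = "map_prod f f"])
  have inj: "inj_on f {0..k}" using f(1) by (rule strict_mono_on_imp_inj_on)
  show "inj_on (map_prod f f) {(j, i). i < j \<and> j \<le> k}"
    by (rule inj_on_subset[OF map_prod_inj_on[OF inj inj]]) auto
  show "map_prod f f ` {(j, i). i < j \<and> j \<le> k} \<subseteq> {(j, i). i < j \<and> j \<le> p}"
    using f by (auto simp: strict_mono_on_def image_subset_iff)
  show "(case a of (j, i) \<Rightarrow> if j \<in> f ` {0..k} \<and> i \<in> f ` {0..k}
      then C (inv_into {0..k} f j) (inv_into {0..k} f i) (x j) (x i) else 1) = 1"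
    if a: "a \<in> {(j, i). i < j \<and> j \<le> p} - map_prod f f ` {(j, i). i < j \<and> j \<le> k}" for a
  proof -
    obtain j i where ji: "a = (j, i)" by fastforce
    have "\<not> (j \<in> f ` {0..k} \<and> i \<in> f ` {0..k})"
    proof
      assume "j \<in> f ` {0..k} \<and> i \<in> f ` {0..k}"
      then obtain b c where bc: "b \<le> k" "c \<le> k" "j = f b" "i = f c" by auto
      then have "c < b" using a ji strict_mono_on_less[OF f(1), of c b] by simp
      then show False using a ji bc by force
    qed
    then show ?thesis unfolding ji by (simp only: prod.case if_False)
  qed
  show "(case map_prod f f b of (j, i) \<Rightarrow> if j \<in> f ` {0..k} \<and> i \<in> f ` {0..k}
      then C (inv_into {0..k} f j) (inv_into {0..k} f i) (x j) (x i) else 1) =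
      (case b of (j, i) \<Rightarrow> C j i (subseq_along k f x j) (subseq_along k f x i))"
    if "b \<in> {(j, i). i < j \<and> j \<le> k}" for b
    using that inv_into_f_f[OF inj] by (auto simp: subseq_along_def)
qed (rule finite_ordered_pairs)

lemma seq_monom_merge:
  assumes "(f, g) \<in> shuffles_rep k l p"
  shows "seq_monom p (shuffle_args k l (f, g) s t) x =
    seq_monom k s (subseq_along k f x) * seq_monom l t (subseq_along l g x)"
proof -
  note d = shuffles_repD[OF assms]
  have "seq_monom p (shuffle_args k l (f, g) s t) x =
    (\<Prod>i=1..p. dpow (x i) (if i \<in> f ` {0..k} then s (inv_into {0..k} f i) else {#}) *
      dpow (x i) (if i \<in> g ` {0..l} then t (inv_into {0..l} g i) else {#}))"
    unfolding seq_monom_def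
    by (rule prod.cong)
      (simp_all only: shuffle_args_split[OF assms] dpow_add atLeastAtMost_iff)
  then show ?thesis
    unfolding prod.distrib prod_dpow_along[OF d(2-4)] prod_dpow_along[OF d(6-8)] .
qed

lemma seq_coeff_merge:
  assumes "(f, g) \<in> shuffles_rep k l p"
  shows "seq_coeff p (shuffle_coeff k l (f, g) C D) x =
    seq_coeff k C (subseq_along k f x) * seq_coeff l D (subseq_along l g x)"
proof -
  note d = shuffles_repD[OF assms]
  show ?thesis
    unfolding prod_pairs_along[OF d(2,4), symmetric]
      prod_pairs_along[OF d(6,8), symmetric] prod.distrib[symmetric]
    unfolding seq_coeff_def
    by (rule prod.cong[OF refl]) (simp only: shuffle_coeff_split split_beta)
qed

section \<open>The product formula\<close>

lemma dcoeff_sum: "dcoeff (\<Sum>i\<in>A. F i) m = (\<Sum>i\<in>A. dcoeff (F i) m)"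
  by (induction A rule: infinite_finite_induct)
    (simp_all add: zero_dseries.rep_eq plus_dseries.rep_eq)

text \<open>
  The Dirichlet product sums over factorisations \<open>m = a b\<close>, then over sequences with monomials \<open>a\<close>
  and \<open>b\<close>; the factorisation is determined by the sequences.  Nonzero arguments are what makes the
  inner sums finite, so that they may be multiplied out and regrouped.
\<close>

lemma dcoeff_L_series_mult:
  fixes s t :: "nat \<Rightarrow> 'v multiset"
  assumes s: "\<And>i. i \<in> {1..k} \<Longrightarrow> s i \<noteq> {#}" and t: "\<And>i. i \<in> {1..l} \<Longrightarrow> t i \<noteq> {#}"
  shows "dcoeff (L_series k C s * L_series l D t) m =
    (\<Sum>(u, w) \<in> {(u, w) \<in> index_seqs k \<times> index_seqs l. seq_monom k s u * seq_monom l t w = m}.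
      seq_coeff k C u * seq_coeff l D w)"
proof -
  let ?P = "{(a, b). a * b = m}"
  let ?U = "\<lambda>a. {u \<in> index_seqs k. seq_monom k s u = a}"
  let ?W = "\<lambda>b. {w \<in> index_seqs l. seq_monom l t w = b}"
  have finU: "finite (?U a)" for a
    unfolding seq_monom_def using s by (rule finite_index_seqs_monom)
  have finW: "finite (?W b)" for b
    unfolding seq_monom_def using t by (rule finite_index_seqs_monom)
  have "dcoeff (L_series k C s * L_series l D t) m =
      (\<Sum>(a, b) \<in> ?P. \<Sum>(u, w) \<in> ?U a \<times> ?W b. seq_coeff k C u * seq_coeff l D w)"
    by (simp add: times_dseries.rep_eq dcoeff_L_series sum_product sum.cartesian_product)
  also have "\<dots> = (\<Sum>q \<in> ?P. \<Sum>(u, w) \<in> ?U (fst q) \<times> ?W (snd q). seq_coeff k C u * seq_coeff l D w)"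
    by (rule sum.cong[OF refl]) auto
  also have "\<dots> = (\<Sum>(u, w) \<in> (\<Union>q \<in> ?P. ?U (fst q) \<times> ?W (snd q)). seq_coeff k C u * seq_coeff l D w)"
    by (rule sum.UNION_disjoint[symmetric]) (use finite_dmonom_factors finU finW in auto)
  also have "(\<Union>q \<in> ?P. ?U (fst q) \<times> ?W (snd q)) =
      {(u, w) \<in> index_seqs k \<times> index_seqs l. seq_monom k s u * seq_monom l t w = m}"
    by auto
  finally show ?thesis .
qed

text \<open>
  If all arguments are nonzero, so are those of \<open>s +\<^sub>\<sigma> t\<close>; hence every coefficient on either side is
  a finite sum and the nested sums can be flattened before they are reindexed by the bijection.
\<close>

theorem L_series_mult:
  fixes C D :: coeff_data and s t :: "nat \<Rightarrow> 'v multiset"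
  assumes s: "\<And>i. s i \<noteq> {#}" and t: "\<And>i. t i \<noteq> {#}"
  shows "L_series k C s * L_series l D t =
    (\<Sum>p = max k l..k + l. \<Sum>\<sigma> \<in> shuffles_rep k l p.
       L_series p (shuffle_coeff k l \<sigma> C D) (shuffle_args k l \<sigma> s t))"
    (is "?lhs = ?rhs")
proof -
  have "dcoeff ?lhs m = dcoeff ?rhs m" for m
  proof -
    let ?F = "\<lambda>(p, (f, g), x). (subseq_along k f x, subseq_along l g x)"
    let ?X = "\<lambda>p \<sigma>. {x \<in> index_seqs p. seq_monom p (shuffle_args k l \<sigma> s t) x = m}"
    let ?T = "SIGMA p:{max k l..k + l}. SIGMA \<sigma>:shuffles_rep k l p. ?X p \<sigma>"
    let ?P = "{(u, w) \<in> index_seqs k \<times> index_seqs l. seq_monom k s u * seq_monom l t w = m}"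
    have finX: "finite (?X p \<sigma>)" for p \<sigma>
      unfolding seq_monom_def
      by (rule finite_index_seqs_monom) (simp add: shuffle_args_def Let_def s t)
    have "?T \<subseteq> (SIGMA p:{max k l..k + l}. shuffles_rep k l p \<times> index_seqs p)" by auto
    moreover have "?F ` ?T = ?P"
    proof (intro equalityI subsetI)
      fix z assume "z \<in> ?F ` ?T"
      then show "z \<in> ?P"
        using bij_betw_imp_surj_on[OF bij_betw_merge[of k l]]
        by (auto simp: seq_monom_merge intro: subseq_along_in_index_seqs dest: shuffles_repD)
    next
      fix z assume z: "z \<in> ?P"
      then have "z \<in> ?F ` (SIGMA p:{max k l..k + l}. shuffles_rep k l p \<times> index_seqs p)"
        unfolding bij_betw_imp_surj_on[OF bij_betw_merge[of k l]] by auto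
      then obtain p f g x where y: "p \<in> {max k l..k + l}" "(f, g) \<in> shuffles_rep k l p"
        "x \<in> index_seqs p" "z = ?F (p, (f, g), x)" by auto
      then have "(p, (f, g), x) \<in> ?T" using z by (simp add: seq_monom_merge)
      then show "z \<in> ?F ` ?T" unfolding y(4) by (rule imageI)
    qed
    ultimately have bij: "bij_betw ?F ?T ?P"
      by (rule bij_betw_subset[OF bij_betw_merge])
    have "dcoeff ?rhs m = (\<Sum>p = max k l..k + l. \<Sum>\<sigma> \<in> shuffles_rep k l p. \<Sum>x \<in> ?X p \<sigma>.
        seq_coeff p (shuffle_coeff k l \<sigma> C D) x)"
      by (simp only: dcoeff_sum dcoeff_L_series)
    also have "\<dots> = (\<Sum>p = max k l..k + l. \<Sum>(\<sigma>, x) \<in> (SIGMA \<sigma>:shuffles_rep k l p. ?X p \<sigma>).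
        seq_coeff p (shuffle_coeff k l \<sigma> C D) x)"
      by (intro sum.cong refl sum.Sigma) (auto intro: finX finite_shuffles_rep)
    also have "\<dots> = (\<Sum>(p, \<sigma>, x) \<in> ?T. seq_coeff p (shuffle_coeff k l \<sigma> C D) x)"
      by (rule sum.Sigma) (auto intro!: finite_SigmaI finX finite_shuffles_rep)
    also have "\<dots> = (\<Sum>y \<in> ?T. case ?F y of (u, w) \<Rightarrow> seq_coeff k C u * seq_coeff l D w)"
      by (rule sum.cong[OF refl]) (auto simp: seq_coeff_merge)
    also have "\<dots> = (\<Sum>(u, w) \<in> ?P. seq_coeff k C u * seq_coeff l D w)"
      using bij by (rule sum.reindex_bij_betw)
    also have "\<dots> = dcoeff ?lhs m"
      by (rule dcoeff_L_series_mult[symmetric]) (rule s, rule t)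
    finally show ?thesis ..
  qed
  then have "dcoeff ?lhs = dcoeff ?rhs" by (rule ext)
  then show ?thesis unfolding dcoeff_inject .
qed

theorem theorem4p2:
  fixes C D :: coeff_data and k l :: nat and s t :: "nat \<Rightarrow> 'v"
  assumes "k \<ge> 1" and "l \<ge> 1"
  shows "L_series k C (\<lambda>i. {#s i#}) * L_series l D (\<lambda>j. {#t j#}) =
    (\<Sum>p = max k l..k + l. \<Sum>\<sigma> \<in> shuffles_rep k l p.
       L_series p (shuffle_coeff k l \<sigma> C D)
         (shuffle_args k l \<sigma> (\<lambda>i. {#s i#}) (\<lambda>j. {#t j#})))"
  by (rule L_series_mult) simp_all

end
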